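(* Let $\star\in\{*,T\}$, let $A\in\mathbb{C}^{n,n}$, and let $L(s)=A+sA^\star$ be a regular $\star$-palindromic pencil. If $\star=*$, then $$\delta_0^{\mathrm{pal}_*}(A,A^* )^2=2\sup_{\gamma\in[0,1]}\lambda_{\min}\big(AA^*+\gamma(A^*A-AA^* )\big),$$ and if $\star=T$, then $$\delta_0^{\mathrm{pal}_T}(A,A^T)^2=2\sup_{\gamma\in[0,1]}\lambda_{\min}\big(\bar{A}A^T+\gamma(A^*A-\bar{A}A^T)\big).$$
   Context: $\mathbb{C}^{n,n}$ is the set of complex $n\times n$ matrices, $A^*$ is the conjugate transpose, $A^T$ the transpose, and $\bar A$ the entrywise conjugate. A pencil $A+sE$ is regular if $A+\lambda E$ is invertible for some $\lambda\in\mathbb{C}$; it is $\star$-palindromic if $E=A^\star$. $\|\cdot\|$ is the spectral norm and $\lambda_{\min}(H)$ is the smallest eigenvalue of a Hermitian matrix $H$. The structured distance to a common null space for $\star$-palindromic pencils is $$\delta_0^{\mathrm{pal}_\star}(A,A^\star)=\inf\Big\{\sqrt{\|\Delta_A\|^2+\|\Delta_A^\star\|^2}\;:\;\Delta_A\in\mathbb{C}^{n,n},\ \ker(A-\Delta_A)\cap\ker(A^\star-\Delta_A^\star)\neq\{0\}\Big\}.$$ *)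

theory Defs
  imports "HOL-Analysis.Analysis"
begin

definition conj_mat :: "complex^'n^'m \<Rightarrow> complex^'n^'m" where
  "conj_mat A = (\<chi> i j. cnj (A $ i $ j))"

definition conj_transpose :: "complex^'n^'m \<Rightarrow> complex^'m^'n" where
  "conj_transpose A = transpose (conj_mat A)"

(* The type class norm on complex^'n^'n is the Frobenius norm; the spectral norm is the
   operator norm induced by the Euclidean norm on complex^'n. *)
definition spectral_norm :: "complex^'n^'m \<Rightarrow> real" where
  "spectral_norm A = onorm ((*v) A)"

definition ker :: "complex^'n^'m \<Rightarrow> (complex^'n) set" where
  "ker A = {x. A *v x = 0}"

(* mat c is c times the identity, so mat c ** E is the scalar multiple c E. *)
definition regular_pencil :: "complex^'n^'n \<Rightarrow> complex^'n^'n \<Rightarrow> bool" where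
  "regular_pencil A E \<longleftrightarrow> (\<exists>c. invertible (A + mat c ** E))"

definition eigenvalues :: "complex^'n^'n \<Rightarrow> complex set" where
  "eigenvalues H = {c. \<exists>x. x \<noteq> 0 \<and> H *v x = c *s x}"

(* Intended for Hermitian H, all of whose eigenvalues are real. *)
definition lambda_min :: "complex^'n^'n \<Rightarrow> real" where
  "lambda_min H = Min {r. complex_of_real r \<in> eigenvalues H}"

(* The structured distance of the pencil A + s (star A) to a common null space, where star is
   one of conj_transpose and transpose. *)
definition pal_dist :: "(complex^'n^'n \<Rightarrow> complex^'n^'n) \<Rightarrow> complex^'n^'n \<Rightarrow> real" where
  "pal_dist star A =
     Inf {sqrt ((spectral_norm D)\<^sup>2 + (spectral_norm (star D))\<^sup>2) | D.
            ker (A - D) \<inter> ker (star A - star D) \<noteq> {0}}"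

end

theory Submission
  imports Defs
begin

text \<open>
  Write \<^term>\<open>B\<close> for \<^term>\<open>star A\<close>.  Two facts give the formula.

  The distance is a minimum over single vectors.  If \<^term>\<open>x\<close> is a unit vector and \<^term>\<open>D\<close>
  an admissible perturbation for which \<^term>\<open>x\<close> is a common null vector, then
  \<^term>\<open>D *v x = A *v x\<close> and \<^term>\<open>star D *v x = B *v x\<close>; since \<^term>\<open>D\<close> and
  \<^term>\<open>star D\<close> have the same spectral norm, this norm is at least the larger of
  \<^term>\<open>norm (A *v x)\<close> and \<^term>\<open>norm (B *v x)\<close>.  Conversely that value can be reached:
  a condition on \<^term>\<open>star D\<close> at \<^term>\<open>x\<close> is one on the adjoint of \<^term>\<open>D\<close> at
  \<^term>\<open>u\<close>, where \<^term>\<open>u\<close> is \<^term>\<open>x\<close> or its entrywise conjugate, and prescribing a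
  matrix on one vector and its adjoint on another costs no more in norm than the larger of the
  two prescriptions (\<open>minimal_norm_interpolation\<close>, a rank-one case of Parrott's
  completion theorem).  So the squared distance is twice the infimum over unit vectors of the
  maximum of \<^term>\<open>(norm (A *v x))\<^sup>2\<close> and \<^term>\<open>(norm (B *v x))\<^sup>2\<close>.

  This infimum equals the supremum of the smallest eigenvalues of the convex combinations of the
  two Gram matrices.  That it is at least the supremum is immediate, because the smallest
  eigenvalue is the minimum of the Rayleigh quotient (\<open>lambda_min_rayleigh\<close>) and a convex
  combination of two numbers is at most their maximum.  The converse
  (\<open>common_bound_of_blends\<close>) is a minimax theorem without convexity of the quadratic forms;
  in place of it stands the freedom to rotate a complex vector by a phase
  (\<open>negative_segment\<close>), the same reason for which the joint numerical range of two
  Hermitian matrices is convex.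
\<close>

section \<open>The Hermitian inner product and the spectral norm\<close>

text \<open>
  The inner product that the type class provides on complex vectors is real valued; it is the
  real part of this one, which is antilinear in its first argument.
\<close>
definition cinner :: "complex^'n \<Rightarrow> complex^'n \<Rightarrow> complex" where
  "cinner x y = (\<Sum>i\<in>UNIV. cnj (x $ i) * y $ i)"

lemma cinner_add_right: "cinner x (y + z) = cinner x y + cinner x z"
  and cinner_diff_right: "cinner x (y - z) = cinner x y - cinner x z"
  and cinner_scale_right: "cinner x (c *s y) = c * cinner x y"
  and cinner_add_left: "cinner (x + w) y = cinner x y + cinner w y"
  and cinner_diff_left: "cinner (x - w) y = cinner x y - cinner w y"
  and cinner_scale_left: "cinner (c *s x) y = cnj c * cinner x y"
  by (simp_all add: cinner_def algebra_simps sum.distrib sum_subtractf sum_distrib_left)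

lemmas cinner_linear = cinner_add_right cinner_diff_right cinner_scale_right
  cinner_add_left cinner_diff_left cinner_scale_left

lemma cnj_cinner: "cnj (cinner x y) = cinner y x"
  by (simp add: cinner_def mult.commute)

lemma Re_cinner: "Re (cinner x y) = x \<bullet> y"
  by (simp add: cinner_def inner_vec_def inner_complex_def)

lemma cinner_self: "cinner x x = of_real ((norm x)\<^sup>2)"
proof -
  have "Im (cinner x x) = 0"
    by (simp add: cinner_def algebra_simps)
  then show ?thesis
    by (simp add: complex_eq_iff Re_cinner power2_norm_eq_inner)
qed

lemma norm_scale: "norm (c *s x) = cmod c * norm (x :: complex^'n)"
  by (simp add: norm_vec_def norm_mult L2_set_right_distrib)

lemma scaleR_eq_scale: "r *\<^sub>R x = complex_of_real r *s (x :: complex^'n)"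
  by (simp add: vec_eq_iff scaleR_conv_of_real[where 'a = complex])

lemma mult_vec_scaleR: "A *v (r *\<^sub>R x) = r *\<^sub>R (A *v x)" for A :: "complex^'n^'m"
  by (simp add: scaleR_eq_scale vector_scalar_commute)

lemma scaleR_mult_vec: "(r *\<^sub>R A) *v x = r *\<^sub>R (A *v x)" for A :: "complex^'n^'m"
  by (simp add: vec_eq_iff matrix_vector_mult_def scaleR_sum_right)

lemma unimodular_rotation: "\<exists>c. cmod c = 1 \<and> c * z = of_real (cmod z)"
proof (cases "z = 0")
  case False
  moreover have "cnj z * z = of_real (cmod z) * of_real (cmod z)"
    using complex_norm_square[of z] by (simp add: power2_eq_square mult.commute)
  ultimately show ?thesis
    by (intro exI[of _ "cnj z / of_real (cmod z)"]) (simp add: norm_divide)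
qed (auto intro: exI[of _ 1])

lemma norm_cinner_le: "cmod (cinner x y) \<le> norm x * norm y"
proof -
  obtain c where c: "cmod c = 1" "c * cinner x y = of_real (cmod (cinner x y))"
    using unimodular_rotation by blast
  have "cmod (cinner x y) = Re (cinner x (c *s y))"
    by (simp add: cinner_linear c(2))
  also have "\<dots> \<le> norm x * norm (c *s y)"
    unfolding Re_cinner by (rule norm_cauchy_schwarz)
  finally show ?thesis by (simp add: norm_scale c(1))
qed

lemma cinner_mult_vec: "cinner x (A *v y) = cinner (conj_transpose A *v x) y"
proof -
  have "cinner x (A *v y) = (\<Sum>i\<in>UNIV. \<Sum>j\<in>UNIV. cnj (x $ i) * (A $ i $ j * y $ j))"
    by (simp add: cinner_def matrix_vector_mult_def sum_distrib_left)
  also have "\<dots> = (\<Sum>j\<in>UNIV. \<Sum>i\<in>UNIV. cnj (x $ i) * (A $ i $ j * y $ j))"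
    by (rule sum.swap)
  also have "\<dots> = cinner (conj_transpose A *v x) y"
    by (simp add: cinner_def matrix_vector_mult_def sum_distrib_left sum_distrib_right conj_transpose_def
        conj_mat_def transpose_def mult_ac)
  finally show ?thesis .
qed

lemma inner_mult_vec: "x \<bullet> (A *v y) = (conj_transpose A *v x) \<bullet> y" for A :: "complex^'n^'m"
  by (metis cinner_mult_vec Re_cinner)

lemma conj_transpose_involution: "conj_transpose (conj_transpose A) = A"
  by (simp add: conj_transpose_def conj_mat_def transpose_def vec_eq_iff)

lemma norm_mult_vec_le: "norm (A *v x) \<le> spectral_norm A * norm x" for A :: "complex^'n^'m"
  unfolding spectral_norm_def by (rule onorm) simp

lemma spectral_norm_nonneg: "0 \<le> spectral_norm (A :: complex^'n^'m)"
  unfolding spectral_norm_def by (rule onorm_pos_le) simp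

lemma spectral_norm_le:
  fixes A :: "complex^'n^'m"
  assumes "\<And>x. norm (A *v x) \<le> \<rho> * norm x"
  shows "spectral_norm A \<le> \<rho>"
  unfolding spectral_norm_def by (rule onorm_le) (rule assms)

text \<open>
  With \<open>y\<close> the image of \<open>x\<close> under the adjoint, the square of the norm of \<open>y\<close> is the inner
  product of \<open>x\<close> with \<open>A y\<close>; Cauchy--Schwarz and division by the norm of \<open>y\<close> give the bound.
\<close>
lemma spectral_norm_conj_transpose_le:
  fixes A :: "complex^'n^'m"
  shows "spectral_norm (conj_transpose A) \<le> spectral_norm A"
proof (rule spectral_norm_le)
  fix x
  let ?y = "conj_transpose A *v x"
  have "norm ?y * norm ?y = x \<bullet> (A *v ?y)"
    by (metis inner_mult_vec power2_norm_eq_inner power2_eq_square)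
  also have "\<dots> \<le> norm x * norm (A *v ?y)" by (rule norm_cauchy_schwarz)
  also have "\<dots> \<le> norm x * (spectral_norm A * norm ?y)"
    by (intro mult_left_mono norm_mult_vec_le) simp
  finally have "norm ?y * norm ?y \<le> (spectral_norm A * norm x) * norm ?y"
    by (simp add: mult_ac)
  then show "norm ?y \<le> spectral_norm A * norm x"
    by (cases "?y = 0") (auto simp: spectral_norm_nonneg)
qed

lemma spectral_norm_conj_transpose: "spectral_norm (conj_transpose A) = spectral_norm A"
  using spectral_norm_conj_transpose_le[of A] spectral_norm_conj_transpose_le[of "conj_transpose A"]
  by (simp add: conj_transpose_involution)

definition conj_vec :: "complex^'n \<Rightarrow> complex^'n" where
  "conj_vec x = (\<chi> i. cnj (x $ i))"

lemma norm_conj_vec: "norm (conj_vec x) = norm x"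
  by (simp add: conj_vec_def norm_vec_def)

text \<open>
  Conjugating vectors turns statements about the transpose into statements about the adjoint,
  which is how the two meanings of \<open>\<star>\<close> are treated alike.
\<close>
lemma transpose_mult_vec: "transpose A *v x = conj_vec (conj_transpose A *v conj_vec x)"
  by (simp add: conj_vec_def conj_transpose_def conj_mat_def transpose_def
      matrix_vector_mult_def vec_eq_iff)

lemma spectral_norm_transpose: "spectral_norm (transpose A) = spectral_norm (A :: complex^'n^'m)"
proof -
  have "spectral_norm (transpose A) \<le> spectral_norm A" for A :: "complex^'p^'q"
  proof (rule spectral_norm_le)
    fix x
    show "norm (transpose A *v x) \<le> spectral_norm A * norm x"
      using norm_mult_vec_le[of "conj_transpose A" "conj_vec x"]
      unfolding transpose_mult_vec by (simp add: norm_conj_vec spectral_norm_conj_transpose)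
  qed
  from this[of A] this[of "transpose A"] show ?thesis by simp
qed

section \<open>Minimal norm interpolation\<close>

lemma norm_orthogonal_sum:
  assumes "norm u = 1" and "cinner u w = 0"
  shows "(norm (p *s u + r *s w))\<^sup>2 = (cmod p)\<^sup>2 + (cmod r)\<^sup>2 * (norm w)\<^sup>2"
proof -
  have "cinner w u = 0" using assms(2) by (metis cnj_cinner complex_cnj_zero)
  then have "cinner (p *s u + r *s w) (p *s u + r *s w)
      = p * cnj p + r * cnj r * of_real ((norm w)\<^sup>2)"
    unfolding cinner_linear using assms by (simp add: cinner_self)
  then have "complex_of_real ((norm (p *s u + r *s w))\<^sup>2)
      = of_real ((cmod p)\<^sup>2 + (cmod r)\<^sup>2 * (norm w)\<^sup>2)"
    unfolding cinner_self of_real_add of_real_mult complex_norm_square .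
  then show ?thesis by (simp only: of_real_eq_iff)
qed

text \<open>
  A two by two matrix with first row \<open>\<alpha>\<close>, \<open>\<beta>\<close> and first column \<open>\<alpha>\<close>, \<open>\<eta>\<close>, where the squared
  moduli of \<open>\<beta>\<close> and \<open>\<eta>\<close> are at most \<open>\<mu>\<close>, is to be completed so that its squared norm is at
  most \<open>(cmod \<alpha>)\<^sup>2 + \<mu>\<close>.  The corner \<open>- cnj \<alpha> * \<beta> * \<eta> / \<mu>\<close> does this, because it makes the mixed
  terms of the two squares below cancel.  Here \<open>\<mu> * k\<close> is \<open>\<beta>\<close> times the second coordinate, which
  keeps the identity polynomial.
\<close>
lemma completion_identity:
  fixes \<alpha> s k :: complex
  shows "(cmod (\<alpha> * s + of_real \<mu> * k))\<^sup>2 + \<mu> * (cmod (s - cnj \<alpha> * k))\<^sup>2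
    = ((cmod \<alpha>)\<^sup>2 + \<mu>) * ((cmod s)\<^sup>2 + \<mu> * (cmod k)\<^sup>2)"
  unfolding cmod_power2 by (simp add: algebra_simps power2_eq_square)

text \<open>
  Split \<open>a\<close> into its component \<open>\<alpha>\<close> along \<open>u\<close> and a remainder \<open>a'\<close>, and \<open>b\<close> into its component
  along \<open>x\<close> and a remainder \<open>b'\<close>; the compatibility condition says that the two components
  are conjugate.  With respect to the directions of \<open>x\<close>, \<open>b'\<close> in the domain and \<open>u\<close>, \<open>a'\<close> in the
  range, the matrix \<open>D\<close> has its first row and column prescribed and one free corner, the multiple
  \<open>\<zeta>\<close> of the outer product of \<open>a'\<close> and \<open>b'\<close>.  The first row and the first column have norm
  at most \<open>\<rho>\<close>, and the corner is chosen as in \<open>completion_identity\<close>.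
\<close>
lemma minimal_norm_interpolation:
  fixes x :: "complex^'n" and u :: "complex^'m"
  assumes x: "norm x = 1" and u: "norm u = 1" and compat: "cinner u a = cinner b x"
    and a: "norm a \<le> \<rho>" and b: "norm b \<le> \<rho>"
  shows "\<exists>D. D *v x = a \<and> conj_transpose D *v u = b \<and> spectral_norm D \<le> \<rho>"
proof -
  define \<alpha> where "\<alpha> = cinner u a"
  define a' where "a' = a - \<alpha> *s u"
  define b' where "b' = b - cnj \<alpha> *s x"
  define \<mu> where "\<mu> = \<rho>\<^sup>2 - (cmod \<alpha>)\<^sup>2"
  define \<zeta> where "\<zeta> = - cnj \<alpha> / of_real \<mu>"
  define D :: "complex^'n^'m" where
    "D = (\<chi> i j. a $ i * cnj (x $ j) + (u + \<zeta> *s a') $ i * cnj (b' $ j))"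
  have hx: "cinner x x = 1" and hu: "cinner u u = 1" by (simp_all add: cinner_self x u)
  have ua': "cinner u a' = 0" by (simp add: a'_def cinner_linear hu \<alpha>_def)
  have b'x: "cinner b' x = 0" using compat by (simp add: b'_def cinner_linear hx \<alpha>_def)
  have a'u: "cinner a' u = 0" and xb': "cinner x b' = 0"
    using ua' b'x by (metis cnj_cinner complex_cnj_zero)+
  have na: "(norm a)\<^sup>2 = (cmod \<alpha>)\<^sup>2 + (norm a')\<^sup>2"
    using norm_orthogonal_sum[OF u ua', of \<alpha> 1] by (simp add: a'_def)
  have nb: "(norm b)\<^sup>2 = (cmod \<alpha>)\<^sup>2 + (norm b')\<^sup>2"
    using norm_orthogonal_sum[OF x xb', of "cnj \<alpha>" 1] by (simp add: b'_def)
  have a'\<mu>: "(norm a')\<^sup>2 \<le> \<mu>" and b'\<mu>: "(norm b')\<^sup>2 \<le> \<mu>"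
    using na nb power_mono[OF a, of 2] power_mono[OF b, of 2] by (simp_all add: \<mu>_def)
  have \<rho>0: "0 \<le> \<rho>" using a norm_ge_zero order_trans by blast
  have D: "D *v v = cinner x v *s a + cinner b' v *s (u + \<zeta> *s a')" for v
    by (simp add: vec_eq_iff D_def matrix_vector_mult_def cinner_def sum.distrib
        algebra_simps sum_distrib_left)
  have D': "conj_transpose D *v y = cinner a y *s x + cinner (u + \<zeta> *s a') y *s b'" for y
    by (simp add: vec_eq_iff D_def matrix_vector_mult_def cinner_def sum.distrib
        algebra_simps sum_distrib_left conj_transpose_def conj_mat_def transpose_def)
  have "norm (D *v v) \<le> \<rho> * norm v" for v
  proof -
    define s where "s = cinner x v"
    define q where "q = cinner b' v"
    \<comment> \<open>Only the coordinate of \<open>v\<close> along \<open>x\<close> and its inner product with \<open>b'\<close> matter;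
      Cauchy--Schwarz orthogonally to \<open>x\<close> bounds the latter.\<close>
    have Dv: "D *v v = (\<alpha> * s + q) *s u + (s + \<zeta> * q) *s a'"
      unfolding D s_def[symmetric] q_def[symmetric]
      by (simp add: a'_def vec_eq_iff algebra_simps)
    have nD: "(norm (D *v v))\<^sup>2 = (cmod (\<alpha> * s + q))\<^sup>2 + (cmod (s + \<zeta> * q))\<^sup>2 * (norm a')\<^sup>2"
      unfolding Dv by (rule norm_orthogonal_sum[OF u ua'])
    define w where "w = v - s *s x"
    have xw: "cinner x w = 0" by (simp add: w_def cinner_linear hx s_def)
    have nv: "(norm v)\<^sup>2 = (cmod s)\<^sup>2 + (norm w)\<^sup>2"
      using norm_orthogonal_sum[OF x xw, of s 1] by (simp add: w_def)
    have "q = cinner b' w" by (simp add: q_def w_def cinner_linear b'x)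
    then have "(cmod q)\<^sup>2 \<le> (norm b' * norm w)\<^sup>2"
      using norm_cinner_le[of b' w] by (simp add: power_mono)
    also have "\<dots> \<le> \<mu> * (norm w)\<^sup>2"
      using b'\<mu> by (simp add: power_mult_distrib mult_right_mono)
    finally have q: "(cmod q)\<^sup>2 \<le> \<mu> * (norm w)\<^sup>2" .
    have "(norm (D *v v))\<^sup>2 \<le> (\<rho> * norm v)\<^sup>2"
    proof (cases "\<mu> = 0")
      \<comment> \<open>Here both remainders vanish, so the quotient by zero in \<open>\<zeta>\<close> multiplies a zero vector.\<close>
      case True
      then have "q = 0" "a' = 0" using q a'\<mu> by simp_all
      moreover have "(cmod \<alpha>)\<^sup>2 = \<rho>\<^sup>2" using True by (simp add: \<mu>_def)
      ultimately show ?thesis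
        by (simp add: nD norm_mult power_mult_distrib nv mult_left_mono)
    next
      case False
      moreover have "0 \<le> \<mu>" using a'\<mu> by (meson order_trans zero_le_power2)
      ultimately have \<mu>: "0 < \<mu>" by simp
      define k where "k = q / of_real \<mu>"
      have qk: "q = of_real \<mu> * k" and \<zeta>k: "s + \<zeta> * q = s - cnj \<alpha> * k"
        using \<mu> by (simp_all add: k_def \<zeta>_def)
      have "\<mu> * (\<mu> * (cmod k)\<^sup>2) \<le> \<mu> * (norm w)\<^sup>2"
        using q \<mu> by (simp add: qk norm_mult power_mult_distrib power2_eq_square mult_ac)
      then have k: "\<mu> * (cmod k)\<^sup>2 \<le> (norm w)\<^sup>2"
        using \<mu> by (simp only: mult_le_cancel_left_pos)
      have "(norm (D *v v))\<^sup>2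
          \<le> (cmod (\<alpha> * s + of_real \<mu> * k))\<^sup>2 + \<mu> * (cmod (s - cnj \<alpha> * k))\<^sup>2"
        unfolding nD \<zeta>k qk[symmetric]
        using mult_left_mono[OF a'\<mu>, of "(cmod (s - cnj \<alpha> * k))\<^sup>2"]
        by (simp add: mult.commute)
      also have "\<dots> = \<rho>\<^sup>2 * ((cmod s)\<^sup>2 + \<mu> * (cmod k)\<^sup>2)"
        unfolding completion_identity by (simp add: \<mu>_def)
      also have "\<dots> \<le> \<rho>\<^sup>2 * ((cmod s)\<^sup>2 + (norm w)\<^sup>2)"
        using k by (intro mult_left_mono add_left_mono) simp_all
      finally show ?thesis by (simp add: nv power_mult_distrib)
    qed
    then show ?thesis
      by (rule power2_le_imp_le) (simp add: \<rho>0)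
  qed
  then have "spectral_norm D \<le> \<rho>" by (rule spectral_norm_le)
  moreover have "D *v x = a" by (simp add: D hx b'x)
  moreover have "conj_transpose D *v u = b"
    using cnj_cinner[of u a]
    by (simp add: D' cinner_linear hu a'u b'_def \<alpha>_def)
  ultimately show ?thesis by blast
qed

section \<open>The smallest eigenvalue of a Hermitian matrix\<close>

definition rayleigh :: "complex^'n^'n \<Rightarrow> complex^'n \<Rightarrow> real" where
  "rayleigh H x = x \<bullet> (H *v x)"

lemma rayleigh_scaleR: "rayleigh H (r *\<^sub>R x) = r\<^sup>2 * rayleigh H x"
  by (simp add: rayleigh_def mult_vec_scaleR power2_eq_square)

lemma continuous_on_rayleigh: "continuous_on S (rayleigh H)"
  unfolding rayleigh_def by (intro continuous_intros linear_continuous_on) simp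

text \<open>
  The form \<open>v \<mapsto> rayleigh H v - m * (norm v)\<^sup>2\<close> is nonnegative and vanishes at \<open>x\<close>.  Moving from
  \<open>x\<close> against its gradient, a multiple of \<open>w = H *v x - m *\<^sub>R x\<close>, would make it negative to
  first order unless \<open>w\<close> is zero.
\<close>
lemma quadratic_minimiser_eigenvector:
  fixes H :: "complex^'n^'n"
  assumes H: "conj_transpose H = H"
    and lower: "\<And>v. m * (norm v)\<^sup>2 \<le> rayleigh H v" and x: "rayleigh H x = m * (norm x)\<^sup>2"
  shows "H *v x = m *\<^sub>R x"
proof (rule ccontr)
  define w where "w = H *v x - m *\<^sub>R x"
  define k where "k = rayleigh H w - m * (norm w)\<^sup>2"
  assume "H *v x \<noteq> m *\<^sub>R x"
  then have w: "0 < w \<bullet> w" by (simp add: w_def)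
  have "0 \<le> k" using lower[of w] by (simp add: k_def)
  have exp: "rayleigh H (x - t *\<^sub>R w) - m * (norm (x - t *\<^sub>R w))\<^sup>2 = t\<^sup>2 * k - 2 * t * (w \<bullet> w)" for t
  proof -
    have sym: "x \<bullet> (H *v w) = w \<bullet> (H *v x)"
      using inner_mult_vec[of x H w] by (simp add: H inner_commute)
    have ww: "w \<bullet> w = w \<bullet> (H *v x) - m * (w \<bullet> x)"
      by (subst (2) w_def) (simp add: inner_diff_right)
    have form: "rayleigh H (x - t *\<^sub>R w) = rayleigh H x - 2 * t * (w \<bullet> (H *v x)) + t\<^sup>2 * rayleigh H w"
      using sym by (simp add: rayleigh_def matrix_vector_mult_diff_distrib mult_vec_scaleR
          inner_diff_left inner_diff_right power2_eq_square algebra_simps)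
    have size: "(norm (x - t *\<^sub>R w))\<^sup>2 = (norm x)\<^sup>2 - 2 * t * (w \<bullet> x) + t\<^sup>2 * (norm w)\<^sup>2"
      unfolding power2_norm_eq_inner
      by (simp add: inner_diff_left inner_diff_right inner_commute[of x w]
          power2_eq_square algebra_simps)
    show ?thesis
      unfolding form size x k_def ww by (simp add: algebra_simps)
  qed
  \<comment> \<open>Any positive \<open>t\<close> with \<open>t * k < 2 * (w \<bullet> w)\<close> will do; \<open>k + 1\<close> avoids dividing by zero.\<close>
  define t where "t = (w \<bullet> w) / (k + 1)"
  have "0 < t" unfolding t_def using w \<open>0 \<le> k\<close> by (intro divide_pos_pos) linarith+
  have "t * k \<le> t * (k + 1)" using \<open>0 < t\<close> by (intro mult_left_mono) linarith+
  also have "\<dots> = w \<bullet> w" unfolding t_def using \<open>0 \<le> k\<close> by (intro nonzero_eq_divide_eq[THEN iffD1]) auto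
  finally have t: "0 < t" "t * k < 2 * (w \<bullet> w)" using w \<open>0 < t\<close> by linarith+
  have "t\<^sup>2 * k - 2 * t * (w \<bullet> w) = t * (t * k - 2 * (w \<bullet> w))"
    by (simp add: power2_eq_square algebra_simps)
  also have "\<dots> < 0" using t by (simp add: mult_pos_neg)
  finally show False using exp[of t] lower[of "x - t *\<^sub>R w"] by simp
qed

lemma real_eigenvalue_iff:
  "complex_of_real r \<in> eigenvalues H \<longleftrightarrow> (\<exists>x. x \<noteq> 0 \<and> H *v x = r *\<^sub>R x)"
  by (simp add: eigenvalues_def scaleR_eq_scale)

text \<open>
  Eigenvectors for distinct eigenvalues are orthogonal, hence linearly independent.  Finiteness
  is what gives \<^const>\<open>Min\<close> in \<^const>\<open>lambda_min\<close> its meaning.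
\<close>
lemma finite_real_eigenvalues:
  fixes H :: "complex^'n^'n"
  assumes H: "conj_transpose H = H"
  shows "finite {r. complex_of_real r \<in> eigenvalues H}" (is "finite ?E")
proof -
  obtain e where e: "\<And>r. r \<in> ?E \<Longrightarrow> e r \<noteq> 0 \<and> H *v e r = r *\<^sub>R e r"
    using real_eigenvalue_iff[of _ H] by (metis mem_Collect_eq)
  have orth: "e r \<bullet> e s = 0" if "r \<in> ?E" "s \<in> ?E" "r \<noteq> s" for r s
  proof -
    have "r * (e r \<bullet> e s) = s * (e r \<bullet> e s)"
      using inner_mult_vec[of "e r" H "e s"] e[OF that(1)] e[OF that(2)] by (auto simp: H)
    with that(3) show ?thesis by simp
  qed
  have "inj_on e ?E"
    by (rule inj_onI) (metis orth e inner_eq_zero_iff)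
  moreover have "independent (e ` ?E)"
  proof (rule pairwise_orthogonal_independent)
    show "pairwise orthogonal (e ` ?E)"
      unfolding pairwise_def orthogonal_def using orth by blast
    show "0 \<notin> e ` ?E" using e by force
  qed
  then have "finite (e ` ?E)" by (rule independent_imp_finite)
  ultimately show ?thesis using finite_imageD by blast
qed

text \<open>
  The minimum of the Rayleigh quotient, attained on the compact unit sphere, is an eigenvalue by
  \<open>quadratic_minimiser_eigenvector\<close>, and every real eigenvalue is a value of the quotient.
\<close>
lemma lambda_min_rayleigh:
  fixes H :: "complex^'n^'n"
  assumes H: "conj_transpose H = H"
  shows "lambda_min H * (norm x)\<^sup>2 \<le> rayleigh H x"
    and "\<exists>x. norm x = 1 \<and> rayleigh H x = lambda_min H"
proof -
  let ?S = "sphere (0 :: complex^'n) 1"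
  have "?S \<noteq> {}" by simp
  then obtain x0 where x0: "x0 \<in> ?S" and min: "\<And>y. y \<in> ?S \<Longrightarrow> rayleigh H x0 \<le> rayleigh H y"
    using continuous_attains_inf[OF compact_sphere _ continuous_on_rayleigh] by metis
  define m where "m = rayleigh H x0"
  have lower: "m * (norm v)\<^sup>2 \<le> rayleigh H v" for v
  proof (cases "v = 0")
    case False
    then have "m \<le> rayleigh H ((1 / norm v) *\<^sub>R v)"
      unfolding m_def by (intro min) simp
    with False show ?thesis by (simp add: rayleigh_scaleR field_simps)
  qed (simp add: rayleigh_def)
  have nx0: "norm x0 = 1" using x0 by simp
  have "H *v x0 = m *\<^sub>R x0"
    by (rule quadratic_minimiser_eigenvector[OF H lower]) (simp add: m_def nx0)
  moreover have "x0 \<noteq> 0" using nx0 by auto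
  ultimately have "m \<in> {r. complex_of_real r \<in> eigenvalues H}"
    using real_eigenvalue_iff by blast
  moreover have "m \<le> r" if "r \<in> {r. complex_of_real r \<in> eigenvalues H}" for r
  proof -
    obtain x where "x \<noteq> 0" "H *v x = r *\<^sub>R x"
      using \<open>r \<in> _\<close> real_eigenvalue_iff by blast
    then show ?thesis
      using lower[of x] by (simp add: rayleigh_def power2_norm_eq_inner)
  qed
  ultimately have "lambda_min H = m"
    unfolding lambda_min_def by (intro Min_eqI finite_real_eigenvalues H)
  then show "lambda_min H * (norm x)\<^sup>2 \<le> rayleigh H x"
    and "\<exists>x. norm x = 1 \<and> rayleigh H x = lambda_min H"
    using lower nx0 m_def by auto
qed

lemma rayleigh_gram: "rayleigh (conj_transpose A ** A) x = (norm (A *v x))\<^sup>2"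
  by (metis rayleigh_def matrix_vector_mul_assoc inner_mult_vec conj_transpose_involution
      power2_norm_eq_inner)

section \<open>A minimax theorem for two Gram matrices\<close>

definition gram_blend :: "complex^'n^'n \<Rightarrow> complex^'n^'n \<Rightarrow> real \<Rightarrow> complex^'n^'n" where
  "gram_blend A B \<gamma> = conj_transpose B ** B
     + \<gamma> *\<^sub>R (conj_transpose A ** A - conj_transpose B ** B)"

lemma conj_transpose_gram_blend: "conj_transpose (gram_blend A B \<gamma>) = gram_blend A B \<gamma>"
  by (simp add: gram_blend_def conj_transpose_def conj_mat_def transpose_def vec_eq_iff
      matrix_matrix_mult_def mult.commute)

lemma rayleigh_gram_blend:
  "rayleigh (gram_blend A B \<gamma>) x
    = (1 - \<gamma>) * (norm (B *v x))\<^sup>2 + \<gamma> * (norm (A *v x))\<^sup>2"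
proof -
  have "rayleigh (gram_blend A B \<gamma>) x = rayleigh (conj_transpose B ** B) x
      + \<gamma> * (rayleigh (conj_transpose A ** A) x - rayleigh (conj_transpose B ** B) x)"
    by (simp add: rayleigh_def gram_blend_def matrix_vector_mult_add_rdistrib
        matrix_vector_mult_diff_rdistrib scaleR_mult_vec
        inner_add_right inner_diff_right)
  then show ?thesis by (simp add: rayleigh_gram algebra_simps)
qed

text \<open>
  The set on which a Hermitian form is negative need not be convex, but two of its points can be
  joined by a segment inside it once one of them is multiplied by a suitable phase: along the
  segment the form is a sum of nonnegative multiples of its two negative end values and of a
  cross term, and the phase makes the cross term nonpositive.  The form here is
  \<open>rayleigh H v - c * (norm v)\<^sup>2\<close>.
\<close>
lemma negative_segment:
  fixes H :: "complex^'n^'n"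
  assumes H: "conj_transpose H = H"
    and x: "rayleigh H x < c * (norm x)\<^sup>2" and y: "rayleigh H y < c * (norm y)\<^sup>2"
  obtains \<omega> where "cmod \<omega> = 1"
    and "\<And>t. \<lbrakk>0 \<le> t; t \<le> 1\<rbrakk> \<Longrightarrow>
      rayleigh H ((1 - t) *\<^sub>R x + t *\<^sub>R (\<omega> *s y)) < c * (norm ((1 - t) *\<^sub>R x + t *\<^sub>R (\<omega> *s y)))\<^sup>2"
proof -
  define K where "K v = rayleigh H v - c * (norm v)\<^sup>2" for v
  define z where "z = cinner x (H *v y) - of_real c * cinner x y"
  obtain \<omega>' where \<omega>': "cmod \<omega>' = 1" "\<omega>' * z = of_real (cmod z)"
    using unimodular_rotation by blast
  define \<omega> where "\<omega> = - \<omega>'"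
  have \<omega>: "cmod \<omega> = 1" using \<omega>' by (simp add: \<omega>_def)
  have "\<omega> * cnj \<omega> = 1"
    using \<omega> complex_norm_square[of \<omega>] by simp
  then have "cinner (\<omega> *s y) (H *v (\<omega> *s y)) = cinner y (H *v y)"
    unfolding vector_scalar_commute cinner_linear by (simp only: mult.assoc[symmetric] mult_1)
  then have Ky: "K (\<omega> *s y) = K y"
    by (simp add: K_def rayleigh_def norm_scale \<omega> flip: Re_cinner)
  have cross: "x \<bullet> (H *v (\<omega> *s y)) - c * (x \<bullet> (\<omega> *s y)) = - cmod z"
  proof -
    have "x \<bullet> (H *v (\<omega> *s y)) - c * (x \<bullet> (\<omega> *s y)) = Re (\<omega> * z)"
      by (simp add: z_def cinner_linear vector_scalar_commute algebra_simps flip: Re_cinner)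
    also have "\<omega> * z = - of_real (cmod z)" using \<omega>'(2) by (simp add: \<omega>_def)
    finally show ?thesis by simp
  qed
  have sym: "(\<omega> *s y) \<bullet> (H *v x) = x \<bullet> (H *v (\<omega> *s y))"
    using inner_mult_vec[of "\<omega> *s y" H x] by (simp add: H inner_commute)
  have K: "K ((1 - t) *\<^sub>R x + t *\<^sub>R (\<omega> *s y))
      = (1 - t)\<^sup>2 * K x + t\<^sup>2 * K y - 2 * t * (1 - t) * cmod z" for t
  proof -
    have "K (p *\<^sub>R x + t *\<^sub>R (\<omega> *s y)) = p\<^sup>2 * K x + t\<^sup>2 * K (\<omega> *s y)
        + 2 * t * p * (x \<bullet> (H *v (\<omega> *s y)) - c * (x \<bullet> (\<omega> *s y)))" for p
      unfolding K_def rayleigh_def power2_norm_eq_inner using sym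
      by (simp add: matrix_vector_right_distrib mult_vec_scaleR inner_add_left inner_add_right
          power2_eq_square inner_commute[of "\<omega> *s y" x] algebra_simps)
    then show ?thesis by (simp add: cross Ky)
  qed
  have "K ((1 - t) *\<^sub>R x + t *\<^sub>R (\<omega> *s y)) < 0" if "0 \<le> t" "t \<le> 1" for t
  proof -
    have neg: "K x < 0" "K y < 0" using x y by (simp_all add: K_def)
    have "(1 - t)\<^sup>2 * K x + t\<^sup>2 * K y < 0"
    proof (cases "t = 0")
      case False
      then have "t\<^sup>2 * K y < 0" using neg by (simp add: mult_pos_neg)
      moreover have "(1 - t)\<^sup>2 * K x \<le> 0" using neg by (simp add: mult_nonneg_nonpos)
      ultimately show ?thesis by simp
    qed (use neg in simp)
    moreover have "0 \<le> 2 * t * (1 - t) * cmod z" using that by simp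
    ultimately show ?thesis unfolding K by linarith
  qed
  then show thesis using that[OF \<omega>] by (simp add: K_def)
qed

text \<open>
  Let \<open>P\<close> and \<open>Q\<close> be the forms of the two Gram matrices minus \<open>c\<close> times the squared norm, and
  suppose that at every nonzero vector one of them is positive.  Each blend takes a negative
  value, at a vector where \<open>P\<close> or \<open>Q\<close> is positive; this splits the parameters into the open sets
  \<open>U\<close> and \<open>V\<close>, which contain 0 and 1.  As the unit interval is connected, some blend is
  negative at a vector \<open>x\<close> with \<open>P x > 0\<close> and at a vector \<open>y\<close> with \<open>Q y > 0\<close>, hence \<open>P y < 0\<close>.
  On a segment from \<open>x\<close> to a rotation of \<open>y\<close> along which the blend stays negative, \<open>P\<close> has a zero,
  and there \<open>Q\<close> is negative: a contradiction.
\<close>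
lemma common_bound_of_blends:
  fixes A B :: "complex^'n^'n"
  assumes less: "\<And>\<gamma>. \<gamma> \<in> {0..1} \<Longrightarrow> lambda_min (gram_blend A B \<gamma>) < c"
  shows "\<exists>x. norm x = 1 \<and> (norm (A *v x))\<^sup>2 \<le> c \<and> (norm (B *v x))\<^sup>2 \<le> c"
proof (rule ccontr)
  define P where "P x = (norm (A *v x))\<^sup>2 - c * (norm x)\<^sup>2" for x
  define Q where "Q x = (norm (B *v x))\<^sup>2 - c * (norm x)\<^sup>2" for x
  assume neg: "\<not> ?thesis"
  have PQ: "0 < P x \<or> 0 < Q x" if "x \<noteq> 0" for x
  proof -
    have "c < (norm (A *v ((1 / norm x) *\<^sub>R x)))\<^sup>2 \<or> c < (norm (B *v ((1 / norm x) *\<^sub>R x)))\<^sup>2"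
      using neg that by (metis norm_sgn sgn_div_norm divide_inverse mult_1 not_le)
    with that show ?thesis
      by (simp add: P_def Q_def mult_vec_scaleR field_simps)
  qed
  have blend: "rayleigh (gram_blend A B \<gamma>) x - c * (norm x)\<^sup>2 = (1 - \<gamma>) * Q x + \<gamma> * P x" for \<gamma> x
    by (simp add: rayleigh_gram_blend P_def Q_def algebra_simps)
  have witness: "\<exists>x. x \<noteq> 0 \<and> (1 - \<gamma>) * Q x + \<gamma> * P x < 0" if \<gamma>: "\<gamma> \<in> {0..1}" for \<gamma>
  proof -
    obtain x where x: "norm x = 1" "rayleigh (gram_blend A B \<gamma>) x = lambda_min (gram_blend A B \<gamma>)"
      using lambda_min_rayleigh(2)[OF conj_transpose_gram_blend] by blast
    then have "x \<noteq> 0" by auto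
    with x show ?thesis using less[OF \<gamma>] blend[of \<gamma> x] by (intro exI[of _ x]) simp
  qed
  define U where "U = (\<Union>x\<in>{x. 0 < P x}. {\<gamma>. (1 - \<gamma>) * Q x + \<gamma> * P x < 0})"
  define V where "V = (\<Union>x\<in>{x. 0 < Q x}. {\<gamma>. (1 - \<gamma>) * Q x + \<gamma> * P x < 0})"
  have "open U" "open V"
    unfolding U_def V_def by (intro open_UN ballI open_Collect_less continuous_intros)+
  moreover have "{0..1} \<subseteq> U \<union> V"
    using witness PQ unfolding U_def V_def by blast
  moreover have "0 \<in> U" using witness[of 0] PQ by (fastforce simp: U_def)
  moreover have "1 \<in> V" using witness[of 1] PQ by (fastforce simp: V_def)
  ultimately have "U \<inter> V \<inter> {0..1} \<noteq> {}"
    using connectedD[OF connected_Icc[of 0 1], of U V] by fastforce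
  then obtain \<gamma> x y where \<gamma>: "0 \<le> \<gamma>" "\<gamma> \<le> 1"
    and x: "0 < P x" "(1 - \<gamma>) * Q x + \<gamma> * P x < 0"
    and y: "0 < Q y" "(1 - \<gamma>) * Q y + \<gamma> * P y < 0"
    unfolding U_def V_def by auto
  have "\<gamma> * P y < 0" using y \<gamma> by (smt (verit) mult_nonneg_nonneg)
  then have Py: "P y < 0" using \<gamma> by (simp add: mult_less_0_iff)
  have "\<gamma> < 1" using x \<gamma> by (cases "\<gamma> = 1") auto
  obtain \<omega> where \<omega>: "cmod \<omega> = 1" and seg: "\<And>t. \<lbrakk>0 \<le> t; t \<le> 1\<rbrakk> \<Longrightarrow>
      rayleigh (gram_blend A B \<gamma>) ((1 - t) *\<^sub>R x + t *\<^sub>R (\<omega> *s y))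
        < c * (norm ((1 - t) *\<^sub>R x + t *\<^sub>R (\<omega> *s y)))\<^sup>2"
    using negative_segment[OF conj_transpose_gram_blend, of A B \<gamma> x c y] x y
      blend[of \<gamma> x] blend[of \<gamma> y] by auto
  define z where "z t = (1 - t) *\<^sub>R x + t *\<^sub>R (\<omega> *s y)" for t
  have "continuous_on {0..1} (\<lambda>t. P (z t))"
    unfolding P_def z_def
    by (intro continuous_intros continuous_on_compose2[OF linear_continuous_on[of "(*v) A" UNIV]]) auto
  moreover have "P (z 1) \<le> 0"
    using Py \<omega> by (simp add: z_def P_def vector_scalar_commute norm_scale)
  moreover have "0 \<le> P (z 0)" using x by (simp add: z_def)
  ultimately obtain t where t: "0 \<le> t" "t \<le> 1" "P (z t) = 0"
    using IVT2'[of "\<lambda>t. P (z t)" 1 0 0] by auto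
  have seg': "(1 - \<gamma>) * Q (z t) + \<gamma> * P (z t) < 0"
    using seg[OF t(1,2)] blend[of \<gamma> "z t"] by (simp add: z_def)
  then have "Q (z t) < 0" using t(3) \<open>\<gamma> < 1\<close> by (simp add: mult_less_0_iff)
  moreover have "z t \<noteq> 0" using seg' by (auto simp: P_def Q_def)
  ultimately show False using PQ t(3) by fastforce
qed

section \<open>The structured distance\<close>

text \<open>
  The argument for both meanings of \<open>\<star>\<close>, with the two properties of \<open>\<star>\<close> that it rests on as
  assumptions.  The upper bound is proved for every \<open>c\<close> above the supremum, which avoids
  showing that the infimum is attained.
\<close>
lemma pal_dist_squared:
  fixes A :: "complex^'n^'n"
  assumes norm_star: "\<And>D. spectral_norm (star D) = spectral_norm D"
    and interpolate: "\<And>x \<rho>. \<lbrakk>norm x = 1; norm (A *v x) \<le> \<rho>; norm (star A *v x) \<le> \<rho>\<rbrakk>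
      \<Longrightarrow> \<exists>D. D *v x = A *v x \<and> star D *v x = star A *v x \<and> spectral_norm D \<le> \<rho>"
  shows "(pal_dist star A)\<^sup>2 = 2 * (SUP \<gamma>\<in>{0..1}. lambda_min (gram_blend A (star A) \<gamma>))"
proof -
  let ?l = "\<lambda>\<gamma>. lambda_min (gram_blend A (star A) \<gamma>)"
  define \<sigma> where "\<sigma> = (SUP \<gamma>\<in>{0..1}. ?l \<gamma>)"
  define S where "S = {sqrt ((spectral_norm D)\<^sup>2 + (spectral_norm (star D))\<^sup>2) | D.
            ker (A - D) \<inter> ker (star A - star D) \<noteq> {0}}"
  have below: "?l \<gamma> \<le> c"
    if "norm x = 1" "(norm (A *v x))\<^sup>2 \<le> c" "(norm (star A *v x))\<^sup>2 \<le> c" "\<gamma> \<in> {0..1}" for x c \<gamma>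
  proof -
    have "?l \<gamma> \<le> (1 - \<gamma>) * (norm (star A *v x))\<^sup>2 + \<gamma> * (norm (A *v x))\<^sup>2"
      using lambda_min_rayleigh(1)[OF conj_transpose_gram_blend, of A "star A" \<gamma> x] that(1)
      by (simp add: rayleigh_gram_blend)
    also have "\<dots> \<le> (1 - \<gamma>) * c + \<gamma> * c"
      using that by (intro add_mono mult_left_mono) auto
    finally show ?thesis by (simp add: algebra_simps)
  qed
  obtain e :: "complex^'n" where e: "norm e = 1"
    using vector_choose_size[of 1] by auto
  have bdd: "bdd_above (?l ` {0..1})"
    by (rule bdd_aboveI2[where M = "max ((norm (A *v e))\<^sup>2) ((norm (star A *v e))\<^sup>2)"])
      (rule below[OF e], auto)
  have \<sigma>0: "0 \<le> \<sigma>"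
  proof -
    obtain x where "rayleigh (gram_blend A (star A) 0) x = ?l 0"
      using lambda_min_rayleigh(2)[OF conj_transpose_gram_blend] by blast
    then have "0 \<le> ?l 0" by (simp add: rayleigh_gram_blend flip: \<open>_ = ?l 0\<close>)
    also have "\<dots> \<le> \<sigma>" unfolding \<sigma>_def by (rule cSUP_upper[OF _ bdd]) simp
    finally show ?thesis .
  qed
  have common_null: "ker M \<inter> ker N \<noteq> {0} \<longleftrightarrow> (\<exists>x. x \<noteq> 0 \<and> M *v x = 0 \<and> N *v x = 0)"
    for M N :: "complex^'n^'n"
    by (auto simp: ker_def)
  have lower: "sqrt (2 * \<sigma>) \<le> s" if "s \<in> S" for s
  proof -
    obtain D x where s: "s = sqrt (2 * (spectral_norm D)\<^sup>2)" and "x \<noteq> 0"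
      "A *v x = D *v x" "star A *v x = star D *v x"
      using \<open>s \<in> S\<close> unfolding S_def common_null
      by (auto simp: norm_star matrix_vector_mult_diff_rdistrib)
    define v where "v = (1 / norm x) *\<^sub>R x"
    have v: "norm v = 1" "A *v v = D *v v" "star A *v v = star D *v v"
      using \<open>x \<noteq> 0\<close> \<open>A *v x = _\<close> \<open>star A *v x = _\<close>
      by (simp_all add: v_def mult_vec_scaleR)
    have "(norm (A *v v))\<^sup>2 \<le> (spectral_norm D)\<^sup>2" "(norm (star A *v v))\<^sup>2 \<le> (spectral_norm D)\<^sup>2"
      using norm_mult_vec_le[of D v] norm_mult_vec_le[of "star D" v] v
      by (simp_all add: norm_star power_mono)
    then have "\<sigma> \<le> (spectral_norm D)\<^sup>2"
      unfolding \<sigma>_def using below[OF v(1)] by (intro cSUP_least) auto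
    then show ?thesis by (simp add: s)
  qed
  have approx: "\<exists>s\<in>S. s \<le> sqrt (2 * c)" if "\<sigma> < c" for c
  proof -
    have "?l \<gamma> < c" if "\<gamma> \<in> {0..1}" for \<gamma>
      using cSUP_upper[OF that bdd] \<open>\<sigma> < c\<close> by (simp add: \<sigma>_def)
    then obtain x where x: "norm x = 1" "(norm (A *v x))\<^sup>2 \<le> c" "(norm (star A *v x))\<^sup>2 \<le> c"
      using common_bound_of_blends by blast
    then obtain D where D: "D *v x = A *v x" "star D *v x = star A *v x" "spectral_norm D \<le> sqrt c"
      using interpolate[of x "sqrt c"] real_le_rsqrt by blast
    have "(spectral_norm D)\<^sup>2 \<le> c"
      using power_mono[OF D(3) spectral_norm_nonneg, of 2] \<sigma>0 \<open>\<sigma> < c\<close> by simp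
    moreover have "x \<noteq> 0" using x by auto
    then have "sqrt ((spectral_norm D)\<^sup>2 + (spectral_norm (star D))\<^sup>2) \<in> S"
      unfolding S_def common_null using D
      by (intro CollectI exI[of _ D]) (auto simp: matrix_vector_mult_diff_rdistrib)
    ultimately show ?thesis by (intro bexI) (auto simp: norm_star)
  qed
  have "Inf S = sqrt (2 * \<sigma>)"
  proof (rule cInf_eq_non_empty)
    show "S \<noteq> {}" using approx[of "\<sigma> + 1"] by auto
    fix y assume y: "\<And>s. s \<in> S \<Longrightarrow> y \<le> s"
    show "y \<le> sqrt (2 * \<sigma>)"
    proof (rule ccontr)
      assume "\<not> ?thesis"
      then have less: "sqrt (2 * \<sigma>) < y" by simp
      have y0: "0 < y" by (rule le_less_trans[OF _ less]) (simp add: \<sigma>0)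
      have "2 * \<sigma> < y\<^sup>2" using less y0 real_less_lsqrt[of y "2 * \<sigma>"] real_sqrt_less_iff[of "2 * \<sigma>" "y\<^sup>2"]
        by simp
      then obtain c where c: "\<sigma> < c" "c < y\<^sup>2 / 2" using dense[of \<sigma> "y\<^sup>2 / 2"] by auto
      then have "sqrt (2 * c) < y" using y0 by (intro real_less_lsqrt) auto
      with approx[OF c(1)] y show False by fastforce
    qed
  qed (rule lower)
  then show ?thesis
    using \<sigma>0 unfolding pal_dist_def S_def[symmetric] \<sigma>_def[symmetric] by simp
qed

text \<open>
  The interpolation data \<open>A x\<close> and \<open>conj_transpose A x\<close> at \<open>u = x\<close> are compatible because
  they come from a matrix and its adjoint; for the transpose the same holds with \<open>u\<close> the conjugate of \<open>x\<close>.
\<close>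
lemma pal_dist_conj_transpose:
  fixes A :: "complex^'n^'n"
  shows "(pal_dist conj_transpose A)\<^sup>2
    = 2 * (SUP \<gamma>\<in>{0..1}. lambda_min (gram_blend A (conj_transpose A) \<gamma>))"
  by (rule pal_dist_squared[OF spectral_norm_conj_transpose])
    (rule minimal_norm_interpolation, simp_all add: cinner_mult_vec)

lemma pal_dist_transpose:
  fixes A :: "complex^'n^'n"
  shows "(pal_dist transpose A)\<^sup>2
    = 2 * (SUP \<gamma>\<in>{0..1}. lambda_min (gram_blend A (transpose A) \<gamma>))"
proof (rule pal_dist_squared[OF spectral_norm_transpose])
  fix x :: "complex^'n" and \<rho>
  assume x: "norm x = 1" "norm (A *v x) \<le> \<rho>" "norm (transpose A *v x) \<le> \<rho>"
  moreover have "norm (conj_transpose A *v conj_vec x) \<le> \<rho>"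
    using x(3) by (simp only: transpose_mult_vec norm_conj_vec)
  ultimately obtain D where "D *v x = A *v x"
    "conj_transpose D *v conj_vec x = conj_transpose A *v conj_vec x" "spectral_norm D \<le> \<rho>"
    using minimal_norm_interpolation[of x "conj_vec x" "A *v x" "conj_transpose A *v conj_vec x" \<rho>]
    by (auto simp: norm_conj_vec cinner_mult_vec)
  then show "\<exists>D. D *v x = A *v x \<and> transpose D *v x = transpose A *v x \<and> spectral_norm D \<le> \<rho>"
    unfolding transpose_mult_vec by metis
qed

lemma conj_transpose_transpose: "conj_transpose (transpose A) = conj_mat A"
  by (simp add: conj_transpose_def conj_mat_def transpose_def vec_eq_iff)

theorem theorem3p7:
  fixes A :: "complex^'n^'n"
    and star :: "complex^'n^'n \<Rightarrow> complex^'n^'n"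
  assumes "star \<in> {conj_transpose, transpose}"
    and "regular_pencil A (star A)"
  shows "(star = conj_transpose \<longrightarrow>
           (pal_dist star A)\<^sup>2 =
             2 * (SUP \<gamma>\<in>{0..1::real}. lambda_min
                   (A ** conj_transpose A
                     + \<gamma> *\<^sub>R (conj_transpose A ** A - A ** conj_transpose A)))) \<and>
         (star = transpose \<longrightarrow>
           (pal_dist star A)\<^sup>2 =
             2 * (SUP \<gamma>\<in>{0..1::real}. lambda_min
                   (conj_mat A ** transpose A
                     + \<gamma> *\<^sub>R (conj_transpose A ** A - conj_mat A ** transpose A))))"
  using pal_dist_conj_transpose[of A] pal_dist_transpose[of A]
  unfolding gram_blend_def conj_transpose_involution conj_transpose_transpose by blast

end
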